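(* If $G$ is an Osin monster group, then $G$ admits a strongly aperiodic subshift of finite type such that the stabilizer of any of its points is trivial.
   Context: An Osin monster group is an infinite finitely generated group in which any two nonidentity elements are conjugate. Let $A$ be a finite alphabet. $G$ acts on $A^G$ by $(gx)_h=x_{g^{-1}h}$. A subshift of finite type (SFT) over $G$ is a set $X\subseteq A^G$ for which there is a finite set $L$ of maps $w:D_w\to A$ ($D_w\subseteq G$ finite) such that $X$ is the set of all $x\in A^G$ such that for every $g\in G$ and $w\in L$ the restriction of $gx$ to $D_w$ differs from $w$. The stabilizer of $x$ is $Stab(x)=\{g\in G:gx=x\}$. A subshift $X$ is strongly aperiodic if it is nonempty and $Stab(x)$ is finite for every $x\in X$. "$G$ admits" such an SFT means one exists over some finite alphabet. *)

theory Defs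
  imports "HOL-Algebra.Group_Action" "HOL-Algebra.Generated_Groups"
begin

definition osin_monster_group :: "('g, 'm) monoid_scheme \<Rightarrow> bool" where
  "osin_monster_group G \<longleftrightarrow>
     group G \<and> infinite (carrier G) \<and>
     (\<exists>S. finite S \<and> S \<subseteq> carrier G \<and> generate G S = carrier G) \<and>
     (\<forall>a \<in> carrier G - {\<one>\<^bsub>G\<^esub>}. \<forall>b \<in> carrier G - {\<one>\<^bsub>G\<^esub>}.
        \<exists>g \<in> carrier G. b = g \<otimes>\<^bsub>G\<^esub> a \<otimes>\<^bsub>G\<^esub> inv\<^bsub>G\<^esub> g)"

(* A configuration is an extensional function in  carrier G \<rightarrow>\<^sub>E A,  so that equality of
   configurations is equality of maps carrier G \<rightarrow> A; restricting to the carrier below keeps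
   this invariant under the action. *)
definition shift_action ::
    "('g, 'm) monoid_scheme \<Rightarrow> 'g \<Rightarrow> ('g \<Rightarrow> 'a) \<Rightarrow> 'g \<Rightarrow> 'a" where
  "shift_action G g x = (\<lambda>h \<in> carrier G. x (inv\<^bsub>G\<^esub> g \<otimes>\<^bsub>G\<^esub> h))"

(* A pattern w is a pair of its domain D and an extensional function on D. *)
definition patterns ::
    "('g, 'm) monoid_scheme \<Rightarrow> 'a set \<Rightarrow> ('g set \<times> ('g \<Rightarrow> 'a)) set" where
  "patterns G A = {(D, w). finite D \<and> D \<subseteq> carrier G \<and> w \<in> D \<rightarrow>\<^sub>E A}"

definition subshift_of_finite_type ::
    "('g, 'm) monoid_scheme \<Rightarrow> 'a set \<Rightarrow> ('g \<Rightarrow> 'a) set \<Rightarrow> bool" where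
  "subshift_of_finite_type G A Y \<longleftrightarrow>
     (\<exists>L. finite L \<and> L \<subseteq> patterns G A \<and>
        Y = {x \<in> carrier G \<rightarrow>\<^sub>E A.
               \<forall>g \<in> carrier G. \<forall>(D, w) \<in> L. restrict (shift_action G g x) D \<noteq> w})"

definition strongly_aperiodic ::
    "('g, 'm) monoid_scheme \<Rightarrow> ('g \<Rightarrow> 'a) set \<Rightarrow> bool" where
  "strongly_aperiodic G Y \<longleftrightarrow>
     Y \<noteq> {} \<and> (\<forall>x \<in> Y. finite (stabilizer G (shift_action G) x))"

end

theory Submission
  imports Defs
begin

text \<open>
  Fix an element \<open>s \<noteq> \<one>\<close> and let the subshift consist of the proper 3-colourings of the graph
  that joins each \<open>g\<close> to \<open>g \<otimes> s\<close>. The rule is local, so this is a subshift of finite type, and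
  it is nonempty because right multiplication by \<open>s\<close> is a permutation without fixed points.

  Its points have trivial stabilizers because every nonidentity \<open>k\<close> has an inverse of the form
  \<open>g \<otimes> s \<otimes> inv g\<close>. If \<open>k\<close> fixed \<open>x\<close>, then comparing \<open>x\<close> with its translate by \<open>k\<close> at the vertex
  \<open>g\<close> would give \<open>x g = x (inv k \<otimes> g) = x (g \<otimes> s)\<close>: two neighbours of the same colour.
\<close>

text \<open>
  Join each \<open>v\<close> to its successor \<open>f v\<close>. A maximal set \<open>M\<close> containing no two neighbours (given by
  Zorn's lemma) gets the first colour. Each vertex outside \<open>M\<close> then has its successor or a
  predecessor in \<open>M\<close>; the other two colours record whether the successor lies in \<open>M\<close>. Two
  consecutive vertices outside \<open>M\<close> differ in this respect, so odd cycles need no separate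
  treatment.
\<close>

lemma fixpoint_free_injection_three_colouring:
  fixes f :: "'v \<Rightarrow> 'v"
  assumes maps: "\<And>v. v \<in> V \<Longrightarrow> f v \<in> V"
    and inj: "inj_on f V"
    and no_fixpoint: "\<And>v. v \<in> V \<Longrightarrow> f v \<noteq> v"
  shows "\<exists>c \<in> V \<rightarrow>\<^sub>E {0, 1, 2 :: nat}. \<forall>v \<in> V. c v \<noteq> c (f v)"
proof -
  define independent where "independent = {I. I \<subseteq> V \<and> (\<forall>v \<in> I. f v \<notin> I)}"
  have "\<exists>M \<in> independent. \<forall>I \<in> independent. M \<subseteq> I \<longrightarrow> I = M"
  proof (rule subset_Zorn')
    fix \<C> assume chain: "subset.chain independent \<C>"
    have "f v \<notin> \<Union>\<C>" if v: "v \<in> \<Union>\<C>" for v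
    proof
      assume "f v \<in> \<Union>\<C>"
      then obtain I J where IJ: "I \<in> \<C>" "v \<in> I" "J \<in> \<C>" "f v \<in> J"
        using v by blast
      have "I \<subseteq> J \<or> J \<subseteq> I"
        using chain IJ(1,3) by (auto simp: subset_chain_def)
      moreover have "I \<in> independent" "J \<in> independent"
        using chain IJ(1,3) by (auto simp: subset_chain_def)
      ultimately show False
        using IJ(2,4) by (auto simp: independent_def)
    qed
    moreover have "\<Union>\<C> \<subseteq> V"
      using chain by (auto simp: subset_chain_def independent_def)
    ultimately show "\<Union>\<C> \<in> independent"
      by (simp add: independent_def)
  qed
  then obtain M where "M \<in> independent"
    and maximal: "\<And>I. I \<in> independent \<Longrightarrow> M \<subseteq> I \<Longrightarrow> I = M"
    by metis
  then have M: "M \<subseteq> V" "\<And>v. v \<in> M \<Longrightarrow> f v \<notin> M"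
    by (auto simp: independent_def)
  have dominating: "f v \<in> M \<or> (\<exists>u \<in> M. f u = v)" if "v \<in> V" "v \<notin> M" for v
  proof (rule ccontr)
    assume "\<not> ?thesis"
    then have "insert v M \<in> independent"
      using that M no_fixpoint[OF that(1)] by (auto simp: independent_def)
    then show False
      using maximal[of "insert v M"] that(2) by blast
  qed
  define c where "c = (\<lambda>v \<in> V. if v \<in> M then 0 else if f v \<in> M then 1 else 2 :: nat)"
  have "c v \<noteq> c (f v)" if v: "v \<in> V" for v
  proof (cases "v \<in> M \<or> f v \<in> M")
    case True
    then show ?thesis
      using v maps[OF v] M(2)[of v] by (auto simp: c_def)
  next
    case False
    \<comment> \<open>By injectivity the only predecessor of \<open>f v\<close> is \<open>v\<close>, so \<open>f v\<close> must be dominated by its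
      own successor.\<close>
    then have "u \<notin> M" if "f u = f v" for u
      using that inj_onD[OF inj that] M(1) v by blast
    then have "f (f v) \<in> M"
      using dominating[OF maps[OF v]] False by blast
    then show ?thesis
      using False v maps[OF v] by (simp add: c_def)
  qed
  moreover have "c \<in> V \<rightarrow>\<^sub>E {0, 1, 2}"
    by (auto simp: c_def)
  ultimately show ?thesis by blast
qed

definition cayley_colourings :: "('g, 'm) monoid_scheme \<Rightarrow> 'g \<Rightarrow> 'a set \<Rightarrow> ('g \<Rightarrow> 'a) set" where
  "cayley_colourings G s A =
     {x \<in> carrier G \<rightarrow>\<^sub>E A. \<forall>g \<in> carrier G. x g \<noteq> x (g \<otimes>\<^bsub>G\<^esub> s)}"

context group
begin

text \<open>
  The forbidden patterns are the constant ones on \<open>{\<one>, s}\<close>: the translate of \<open>x\<close> by \<open>g\<close> shows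
  there the values of \<open>x\<close> at \<open>inv g\<close> and \<open>inv g \<otimes> s\<close>, and \<open>inv g\<close> runs through the whole group.
\<close>

lemma cayley_colourings_subshift_of_finite_type:
  fixes A :: "'c set"
  assumes s: "s \<in> carrier G" and "finite A"
  shows "subshift_of_finite_type G A (cayley_colourings G s A)"
proof -
  define L where "L = (\<lambda>a. ({\<one>, s}, \<lambda>h \<in> {\<one>, s}. a)) ` A"
  have pattern_occurs: "restrict (shift_action G g x) {\<one>, s} = (\<lambda>h \<in> {\<one>, s}. a) \<longleftrightarrow>
      x (inv g) = a \<and> x (inv g \<otimes> s) = a" if "g \<in> carrier G" for g a and x :: "'a \<Rightarrow> 'c"
    using s that by (auto simp: fun_eq_iff shift_action_def restrict_def)
  have "(\<forall>g \<in> carrier G. x g \<noteq> x (g \<otimes> s)) \<longleftrightarrow>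
      (\<forall>g \<in> carrier G. \<forall>(D, w) \<in> L. restrict (shift_action G g x) D \<noteq> w)"
    if x: "x \<in> carrier G \<rightarrow>\<^sub>E A" for x
  proof -
    have "(\<forall>g \<in> carrier G. \<forall>(D, w) \<in> L. restrict (shift_action G g x) D \<noteq> w) \<longleftrightarrow>
        (\<forall>g \<in> carrier G. \<forall>a \<in> A. \<not> (x (inv g) = a \<and> x (inv g \<otimes> s) = a))"
      by (simp add: L_def pattern_occurs)
    also have "\<dots> \<longleftrightarrow> (\<forall>g \<in> carrier G. x (inv g) \<noteq> x (inv g \<otimes> s))"
      using PiE_mem[OF x] by (metis inv_closed)
    also have "\<dots> \<longleftrightarrow> (\<forall>g \<in> carrier G. x g \<noteq> x (g \<otimes> s))"
      by (metis inv_closed inv_inv)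
    finally show ?thesis by simp
  qed
  then have "cayley_colourings G s A = {x \<in> carrier G \<rightarrow>\<^sub>E A.
      \<forall>g \<in> carrier G. \<forall>(D, w) \<in> L. restrict (shift_action G g x) D \<noteq> w}"
    unfolding cayley_colourings_def by blast
  moreover have "finite L" "L \<subseteq> patterns G A"
    using assms by (auto simp: L_def patterns_def split: if_splits)
  ultimately show ?thesis
    unfolding subshift_of_finite_type_def by blast
qed

lemma cayley_three_colourings_nonempty:
  assumes "s \<in> carrier G" "s \<noteq> \<one>"
  shows "cayley_colourings G s {0, 1, 2 :: nat} \<noteq> {}"
proof -
  have "\<exists>c \<in> carrier G \<rightarrow>\<^sub>E {0, 1, 2 :: nat}. \<forall>g \<in> carrier G. c g \<noteq> c (g \<otimes> s)"
    using assms by (intro fixpoint_free_injection_three_colouring) (auto intro: inj_onI)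
  then show ?thesis
    unfolding cayley_colourings_def by blast
qed

lemma stabilizer_cayley_colouring_trivial:
  assumes s: "s \<in> carrier G"
    and conjugate: "\<And>k. k \<in> carrier G \<Longrightarrow> k \<noteq> \<one> \<Longrightarrow> \<exists>g \<in> carrier G. k = g \<otimes> s \<otimes> inv g"
    and x: "x \<in> cayley_colourings G s A"
  shows "stabilizer G (shift_action G) x = {\<one>}"
proof -
  have "k = \<one>" if k: "k \<in> carrier G" and fixes_x: "shift_action G k x = x" for k
  proof (rule ccontr)
    assume "k \<noteq> \<one>"
    then obtain g where g: "g \<in> carrier G" "inv k = g \<otimes> s \<otimes> inv g"
      using conjugate[of "inv k"] k by (auto simp: inv_eq_1_iff)
    then have "inv k \<otimes> g = g \<otimes> s"
      using s by (simp add: m_assoc)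
    then have "x g = x (g \<otimes> s)"
      using fun_cong[OF fixes_x, of g] g(1) by (simp add: shift_action_def)
    then show False
      using x g(1) by (simp add: cayley_colourings_def)
  qed
  moreover have "shift_action G \<one> x = x"
  proof
    fix h
    show "shift_action G \<one> x h = x h"
      using x by (cases "h \<in> carrier G")
        (auto simp: shift_action_def cayley_colourings_def PiE_def extensional_def)
  qed
  ultimately show ?thesis
    by (auto simp: stabilizer_def)
qed

end

(* Every finite alphabet can be relabelled by natural numbers. *)
theorem proposition4p3:
  fixes G :: "('g, 'm) monoid_scheme"
  assumes "osin_monster_group G"
  shows "\<exists>(A :: nat set) Y. finite A \<and> subshift_of_finite_type G A Y \<and>
           strongly_aperiodic G Y \<and>
           (\<forall>x \<in> Y. stabilizer G (shift_action G) x = {\<one>\<^bsub>G\<^esub>})"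
proof -
  interpret group G
    using assms by (simp add: osin_monster_group_def)
  have "infinite (carrier G)"
    using assms by (simp add: osin_monster_group_def)
  then obtain s where s: "s \<in> carrier G" "s \<noteq> \<one>\<^bsub>G\<^esub>"
    by (metis finite.emptyI finite_insert finite_subset insertI1 subsetI)
  then have conjugate: "\<exists>g \<in> carrier G. k = g \<otimes>\<^bsub>G\<^esub> s \<otimes>\<^bsub>G\<^esub> inv\<^bsub>G\<^esub> g"
    if "k \<in> carrier G" "k \<noteq> \<one>\<^bsub>G\<^esub>" for k
    using assms that by (simp add: osin_monster_group_def)
  let ?A = "{0, 1, 2 :: nat}"
  let ?Y = "cayley_colourings G s ?A"
  have trivial: "\<forall>x \<in> ?Y. stabilizer G (shift_action G) x = {\<one>\<^bsub>G\<^esub>}"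
    using stabilizer_cayley_colouring_trivial[OF s(1) conjugate] by blast
  then have "strongly_aperiodic G ?Y"
    using cayley_three_colourings_nonempty[OF s] by (simp add: strongly_aperiodic_def)
  moreover have "subshift_of_finite_type G ?A ?Y"
    by (rule cayley_colourings_subshift_of_finite_type[OF s(1)]) simp
  ultimately show ?thesis
    using trivial by (intro exI[of _ ?A] exI[of _ ?Y]) simp
qed

end
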